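(* Consider the Riemann problem with initial states $U_1=(D_1,S_1)$ on link 1 and $U_2=(D_2,S_2)$ on link 2. Its stationary states $U_1^-,U_2^+$ and interior states $U_1(0^-,t),U_2(0^+,t)$ are the following: 1. When $D_1<S_2$, there are unique stationary and interior states: $U_1^-=U_1(0^-,t)=(D_1,C_1)$ and $U_2^+=U_2(0^+,t)=(D_1,C_2)$. 2. When $D_1>S_2$, there are unique stationary and interior states: $U_1^-=U_1(0^-,t)=(C_1,S_2)$ and $U_2^+=U_2(0^+,t)=(C_2,S_2)$. 3. When $D_1=S_2$, there are unique stationary states: $U_1^-=(D_1,C_1)$ and $U_2^+=(C_2,S_2)$; but the interior states may not be unique: they are given by either $U_1(0^-,t)=(D_1,C_1)$ together with $D_2(0^+,t)\ge S_2$ and $S_2(0^+,t)\ge S_2$, or $U_2(0^+,t)=(C_2,S_2)$ together with $S_1(0^-,t)\ge D_1$ and $D_1(0^-,t)\ge D_1$.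
   Context: Setting: the inhomogeneous Lighthill-Whitham-Richards (LWR) model $\partial_t\rho+\partial_x Q(x,\rho)=0$, with $Q(x,\rho)=Q_1(\rho)$ for $x<0$ (upstream link 1) and $Q(x,\rho)=Q_2(\rho)$ for $x>0$ (downstream link 2). Each $Q_i$ is continuous and unimodal (strictly increasing, then strictly decreasing, vanishing at zero and at jam density) with capacity (maximum) $C_i>0$ attained at the critical density $\rho_{c,i}$. A density $\rho$ on link $i$ is represented by its demand $D=Q_i(\min\{\rho,\rho_{c,i}\})$ and supply $S=Q_i(\max\{\rho,\rho_{c,i}\})$; this identifies densities on link $i$ with traffic states of link $i$, i.e. pairs $U=(D,S)$ with $D,S\ge0$ and $\max\{D,S\}=C_i$. The flux of a state is $q(U)=\min\{D,S\}$. Riemann problem: the initial condition is $U(x,0)=U_1=(D_1,S_1)$ for $x<0$ and $U(x,0)=U_2=(D_2,S_2)$ for $x>0$, with $U_i$ a traffic state of link $i$. The stationary and interior states of the Riemann problem are the traffic states (constant for $t>0$) $U_1^-=(D_1^-,S_1^-)$ and $U_1(0^-,t)=(D_1(0^-,t),S_1(0^-,t))$ of link 1, and $U_2^+=(D_2^+,S_2^+)$ and $U_2(0^+,t)=(D_2(0^+,t),S_2(0^+,t))$ of link 2, together with a boundary flux $q_{1\to2}(0,t)$, satisfying all of the following conditions. (i) Traffic conservation: $q_{1\to2}(0,t)=q(U_1^-)=q(U_2^+)$. (ii) Admissibility of stationary states: $U_1^-=(D_1,C_1)$, or $U_1^-=(C_1,S_1^-)$ with $S_1^-<D_1$; and $U_2^+=(C_2,S_2)$,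 or $U_2^+=(D_2^+,C_2)$ with $D_2^+<S_2$. (iii) Admissibility of interior states: if $S_1^-<D_1^-=C_1$ then $U_1(0^-,t)=U_1^-$, and if $D_1^-\le S_1^-=C_1$ then $S_1(0^-,t)\ge D_1^-$; if $D_2^+<S_2^+=C_2$ then $U_2(0^+,t)=U_2^+$, and if $S_2^+\le D_2^+=C_2$ then $D_2(0^+,t)\ge S_2^+$. (iv) Entropy condition: $q_{1\to2}(0,t)=\min\{D_1(0^-,t),S_2(0^+,t)\}$. *)

theory Defs
  imports Complex_Main
begin

locale link =
  fixes Q :: "real \<Rightarrow> real" and \<rho>c \<rho>j C :: real
  assumes crit: "0 < \<rho>c" "\<rho>c < \<rho>j"
    and cont: "continuous_on {0..\<rho>j} Q"
    and inc: "strict_mono_on {0..\<rho>c} Q"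
    and dec: "strict_antimono_on {\<rho>c..\<rho>j} Q"
    and Q_zero: "Q 0 = 0"
    and Q_jam: "Q \<rho>j = 0"
    and capacity: "C = Q \<rho>c"

text \<open>Pairs (demand, supply).\<close>

type_synonym state = "real \<times> real"

abbreviation demand_of :: "state \<Rightarrow> real" where "demand_of \<equiv> fst"
abbreviation supply_of :: "state \<Rightarrow> real" where "supply_of \<equiv> snd"

definition traffic_states :: "real \<Rightarrow> state set" where
  "traffic_states C = {(D, S). 0 \<le> D \<and> 0 \<le> S \<and> max D S = C}"

definition flux :: "state \<Rightarrow> real" where
  "flux U = min (demand_of U) (supply_of U)"

definition state_of_density :: "(real \<Rightarrow> real) \<Rightarrow> real \<Rightarrow> real \<Rightarrow> state" where
  "state_of_density Q \<rho>c \<rho> = (Q (min \<rho> \<rho>c), Q (max \<rho> \<rho>c))"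

context link
begin

lemma capacity_pos: "0 < C"
  using crit Q_zero capacity monotone_onD[OF inc, of 0 \<rho>c] by auto

lemma Q_le_C: "Q \<rho> \<le> C" if "\<rho> \<in> {0..\<rho>j}"
proof (cases "\<rho> \<le> \<rho>c")
  case True
  then show ?thesis
    using that crit capacity strict_mono_on_leD[OF inc, of \<rho> \<rho>c] by auto
next
  case False
  then show ?thesis
    using that crit capacity monotone_onD[OF dec, of \<rho>c \<rho>] by auto
qed

lemma Q_nonneg: "0 \<le> Q \<rho>" if "\<rho> \<in> {0..\<rho>j}"
proof (cases "\<rho> \<le> \<rho>c")
  case True
  then show ?thesis
    using that crit Q_zero strict_mono_on_leD[OF inc, of 0 \<rho>] by auto
next
  case False
  then show ?thesis
    using that crit Q_jam monotone_onD[OF dec, of \<rho> \<rho>j]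
    by (cases "\<rho> = \<rho>j") auto
qed

text \<open>Densities of a link are in bijection with its traffic states, and the flux of
  a state is the flow-rate of the density, so everything below can be phrased in terms of
  states alone.\<close>

lemma flux_state_of_density:
  assumes "\<rho> \<in> {0..\<rho>j}"
  shows "flux (state_of_density Q \<rho>c \<rho>) = Q \<rho>"
  using assms Q_le_C[of \<rho>] capacity
  by (auto simp: flux_def state_of_density_def min_def max_def)

lemma bij_betw_state_of_density:
  "bij_betw (state_of_density Q \<rho>c) {0..\<rho>j} (traffic_states C)"
proof -
  have inj1: "x = y" if "Q x = Q y" "x \<in> {0..\<rho>c}" "y \<in> {0..\<rho>c}" for x y
    using that monotone_onD[OF inc, of x y] monotone_onD[OF inc, of y x]
    by (cases x y rule: linorder_cases) auto
  have inj2: "x = y" if "Q x = Q y" "x \<in> {\<rho>c..\<rho>j}" "y \<in> {\<rho>c..\<rho>j}" for x y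
    using that monotone_onD[OF dec, of x y] monotone_onD[OF dec, of y x]
    by (cases x y rule: linorder_cases) auto
  have "inj_on (state_of_density Q \<rho>c) {0..\<rho>j}"
  proof (rule inj_onI)
    fix x y assume x: "x \<in> {0..\<rho>j}" and y: "y \<in> {0..\<rho>j}"
      and e: "state_of_density Q \<rho>c x = state_of_density Q \<rho>c y"
    have "min x \<rho>c = min y \<rho>c"
      using x y crit e by - (rule inj1, auto simp: state_of_density_def)
    moreover have "max x \<rho>c = max y \<rho>c"
      using x y crit e by - (rule inj2, auto simp: state_of_density_def)
    ultimately show "x = y" by (auto simp: min_def max_def split: if_splits)
  qed
  moreover have "state_of_density Q \<rho>c ` {0..\<rho>j} = traffic_states C"
  proof
    show "state_of_density Q \<rho>c ` {0..\<rho>j} \<subseteq> traffic_states C"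
      using Q_le_C Q_nonneg crit capacity
      by (force simp: state_of_density_def traffic_states_def min_def max_def)
    show "traffic_states C \<subseteq> state_of_density Q \<rho>c ` {0..\<rho>j}"
    proof
      fix U assume "U \<in> traffic_states C"
      then obtain D S where U: "U = (D, S)" "0 \<le> D" "0 \<le> S" "max D S = C"
        by (auto simp: traffic_states_def)
      show "U \<in> state_of_density Q \<rho>c ` {0..\<rho>j}"
      proof (cases "S = C")
        case True
        obtain x where "0 \<le> x" "x \<le> \<rho>c" "Q x = D"
          using IVT'[of Q 0 D \<rho>c] U crit Q_zero capacity
            continuous_on_subset[OF cont, of "{0..\<rho>c}"] by fastforce
        then show ?thesis
          using U True crit capacity
          by (intro image_eqI[of _ _ x]) (auto simp: state_of_density_def)
      next
        case False
        then have "D = C" "S \<le> C" using U by (auto simp: max_def split: if_splits)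
        moreover obtain x where "\<rho>c \<le> x" "x \<le> \<rho>j" "Q x = S"
          using IVT2'[of Q \<rho>j S \<rho>c] U crit Q_jam capacity
            continuous_on_subset[OF cont, of "{\<rho>c..\<rho>j}"] by fastforce
        ultimately show ?thesis
          using U crit capacity
          by (intro image_eqI[of _ _ x]) (auto simp: state_of_density_def)
      qed
    qed
  qed
  ultimately show ?thesis by (simp add: bij_betw_def)
qed

end

text \<open>Stationary states \<open>U1m\<close> (link 1), \<open>U2p\<close> (link 2), interior states
  \<open>U1i\<close> (at \<open>0-\<close>), \<open>U2i\<close> (at \<open>0+\<close>) and boundary flux \<open>q\<close>
  of the Riemann problem with initial states \<open>U1\<close>, \<open>U2\<close>.\<close>

definition stationary1 :: "real \<Rightarrow> state \<Rightarrow> state \<Rightarrow> bool" where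
  "stationary1 C1 U1 U1m \<longleftrightarrow>
     U1m = (demand_of U1, C1) \<or> (demand_of U1m = C1 \<and> supply_of U1m < demand_of U1)"

definition stationary2 :: "real \<Rightarrow> state \<Rightarrow> state \<Rightarrow> bool" where
  "stationary2 C2 U2 U2p \<longleftrightarrow>
     U2p = (C2, supply_of U2) \<or> (supply_of U2p = C2 \<and> demand_of U2p < supply_of U2)"

definition interior1 :: "real \<Rightarrow> state \<Rightarrow> state \<Rightarrow> bool" where
  "interior1 C1 U1m U1i \<longleftrightarrow>
     (supply_of U1m < demand_of U1m \<and> demand_of U1m = C1 \<longrightarrow> U1i = U1m) \<and>
     (demand_of U1m \<le> supply_of U1m \<and> supply_of U1m = C1 \<longrightarrow> demand_of U1m \<le> supply_of U1i)"

definition interior2 :: "real \<Rightarrow> state \<Rightarrow> state \<Rightarrow> bool" where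
  "interior2 C2 U2p U2i \<longleftrightarrow>
     (demand_of U2p < supply_of U2p \<and> supply_of U2p = C2 \<longrightarrow> U2i = U2p) \<and>
     (supply_of U2p \<le> demand_of U2p \<and> demand_of U2p = C2 \<longrightarrow> supply_of U2p \<le> demand_of U2i)"

definition riemann_states ::
  "real \<Rightarrow> real \<Rightarrow> state \<Rightarrow> state \<Rightarrow> state \<Rightarrow> state \<Rightarrow> state \<Rightarrow> state \<Rightarrow> real \<Rightarrow> bool" where
  "riemann_states C1 C2 U1 U2 U1m U1i U2i U2p q \<longleftrightarrow>
     U1m \<in> traffic_states C1 \<and> U1i \<in> traffic_states C1 \<and>
     U2i \<in> traffic_states C2 \<and> U2p \<in> traffic_states C2 \<and>
     q = flux U1m \<and> q = flux U2p \<and>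
     stationary1 C1 U1 U1m \<and> stationary2 C2 U2 U2p \<and>
     interior1 C1 U1m U1i \<and> interior2 C2 U2p U2i \<and>
     q = min (demand_of U1i) (supply_of U2i)"

end

theory Submission
  imports Defs
begin

text \<open>
  On each link the stationary state is determined by the boundary flux \<open>q\<close>.
  Upstream, \<open>q\<close> cannot exceed the demand \<open>D1\<close>. If \<open>q = D1\<close>, the
  link discharges all it wants to, the stationary state is \<open>(D1, C1)\<close>, and the interior
  state is only required to have supply at least \<open>D1\<close>. If \<open>q < D1\<close>, a queue
  forms, and both the stationary and the interior state are forced to be \<open>(C1, q)\<close>
  (\<open>upstream_dichotomy\<close>). Exchanging demand with supply and upstream with
  downstream maps the problem to itself, so the same alternative holds downstream with
  \<open>S2\<close> in place of \<open>D1\<close> (\<open>downstream_dichotomy\<close>).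

  The entropy condition then settles which of the four combinations occurs. A queued upstream
  link offers its full capacity \<open>C1\<close> at the interface, and a starved downstream link
  (\<open>q < S2\<close>) offers the supply \<open>C2\<close>. Both at once would give
  \<open>q = min C1 C2\<close>, impossible because \<open>q < D1 \<le> C1\<close> and
  \<open>q < S2 \<le> C2\<close>. Hence \<open>q = min D1 S2\<close>
  (\<open>boundary_flux_eq\<close>): the smaller of the two numbers is attained, the link with
  the larger one has a forced interior state, and entropy then pins down the other interior state.
  When \<open>D1 = S2\<close> neither interior state is forced; entropy says only that one of them
  realises the minimum, which leaves room for many choices of the other.
\<close>

lemma traffic_state_bounds:
  assumes "U \<in> traffic_states C"
  shows "0 \<le> demand_of U" "demand_of U \<le> C" "0 \<le> supply_of U" "supply_of U \<le> C"
  using assms by (auto simp: traffic_states_def max_def split: if_splits)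

lemma undercritical_state_eq:
  assumes "U \<in> traffic_states C" "demand_of U \<le> supply_of U"
  shows "U = (demand_of U, C)"
  using assms by (cases U) (auto simp: traffic_states_def max_def)

lemma swap_mem_traffic_states_iff:
  "prod.swap U \<in> traffic_states C \<longleftrightarrow> U \<in> traffic_states C"
  by (cases U) (auto simp: traffic_states_def max.commute)

lemma swap_eq_Pair_iff: "prod.swap U = (a, b) \<longleftrightarrow> U = (b, a)"
  by (cases U) auto

lemma flux_swap: "flux (prod.swap U) = flux U"
  by (simp add: flux_def min.commute)

lemma stationary_swap:
  "stationary1 C (prod.swap U) (prod.swap V) \<longleftrightarrow> stationary2 C U V"
  by (cases U; cases V) (auto simp: stationary1_def stationary2_def)

lemma interior_swap:
  "interior1 C (prod.swap V) (prod.swap W) \<longleftrightarrow> interior2 C V W"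
  by (cases V; cases W) (auto simp: interior1_def interior2_def)

text \<open>
  Vehicles moving downstream are holes moving upstream: reversing the road exchanges the two
  links and, on each of them, demand and supply.
\<close>

lemma riemann_states_reverse:
  "riemann_states C1 C2 U1 U2 U1m U1i U2i U2p q \<longleftrightarrow>
   riemann_states C2 C1 (prod.swap U2) (prod.swap U1)
     (prod.swap U2p) (prod.swap U2i) (prod.swap U1i) (prod.swap U1m) q"
  using stationary_swap[of C2 U2 U2p] stationary_swap[of C1 "prod.swap U1" "prod.swap U1m"]
    interior_swap[of C2 U2p U2i] interior_swap[of C1 "prod.swap U1m" "prod.swap U1i"]
  by (auto simp: riemann_states_def swap_mem_traffic_states_iff flux_swap min.commute)

text \<open>
  The strict inequality in the congested alternative of the stationary condition means that a
  stationary state whose flux falls short of the demand is strictly overcritical, and this is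
  exactly when the interior state has to coincide with it.
\<close>

lemma upstream_dichotomy:
  assumes "U1 \<in> traffic_states C1"
  shows "U1m \<in> traffic_states C1 \<and> U1i \<in> traffic_states C1 \<and> flux U1m = q \<and>
      stationary1 C1 U1 U1m \<and> interior1 C1 U1m U1i \<longleftrightarrow>
    q = demand_of U1 \<and> U1m = (q, C1) \<and> U1i \<in> traffic_states C1 \<and> q \<le> supply_of U1i \<or>
    0 \<le> q \<and> q < demand_of U1 \<and> U1m = (C1, q) \<and> U1i = (C1, q)"
    (is "?L \<longleftrightarrow> ?free \<or> ?forced")
proof
  note d = traffic_state_bounds[OF assms]
  assume L: ?L
  then consider "U1m = (demand_of U1, C1)"
    | "demand_of U1m = C1" "supply_of U1m < demand_of U1"
    unfolding stationary1_def by blast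
  then show "?free \<or> ?forced"
  proof cases
    case 1
    then have "q = demand_of U1"
      using L d by (simp add: flux_def)
    moreover have "demand_of U1 \<le> supply_of U1i"
      using L 1 d by (simp add: interior1_def)
    ultimately show ?thesis using L 1 by simp
  next
    case 2
    then have "supply_of U1m < C1" using d by simp
    then have "q = supply_of U1m" "U1i = U1m"
      using L 2 by (simp_all add: flux_def interior1_def)
    then have ?forced
      using L 2 traffic_state_bounds[of U1m C1] by (simp add: prod_eq_iff)
    then show ?thesis ..
  qed
next
  note d = traffic_state_bounds[OF assms]
  assume "?free \<or> ?forced"
  then show ?L
  proof
    assume ?free
    then show ?L
      using d by (simp add: traffic_states_def flux_def stationary1_def interior1_def)
  next
    assume ?forced
    then show ?L
      using d by (simp add: traffic_states_def flux_def stationary1_def interior1_def)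
  qed
qed

lemma downstream_dichotomy:
  assumes "U2 \<in> traffic_states C2"
  shows "U2p \<in> traffic_states C2 \<and> U2i \<in> traffic_states C2 \<and> flux U2p = q \<and>
      stationary2 C2 U2 U2p \<and> interior2 C2 U2p U2i \<longleftrightarrow>
    q = supply_of U2 \<and> U2p = (C2, q) \<and> U2i \<in> traffic_states C2 \<and> q \<le> demand_of U2i \<or>
    0 \<le> q \<and> q < supply_of U2 \<and> U2p = (q, C2) \<and> U2i = (q, C2)"
  using upstream_dichotomy[of "prod.swap U2" C2 "prod.swap U2p" "prod.swap U2i" q] assms
  by (simp add: swap_mem_traffic_states_iff flux_swap stationary_swap interior_swap swap_eq_Pair_iff)

lemma riemann_states_iff:
  assumes "U1 \<in> traffic_states C1" "U2 \<in> traffic_states C2"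
  shows "riemann_states C1 C2 U1 U2 U1m U1i U2i U2p q \<longleftrightarrow>
    (q = demand_of U1 \<and> U1m = (q, C1) \<and> U1i \<in> traffic_states C1 \<and> q \<le> supply_of U1i \<or>
     0 \<le> q \<and> q < demand_of U1 \<and> U1m = (C1, q) \<and> U1i = (C1, q)) \<and>
    (q = supply_of U2 \<and> U2p = (C2, q) \<and> U2i \<in> traffic_states C2 \<and> q \<le> demand_of U2i \<or>
     0 \<le> q \<and> q < supply_of U2 \<and> U2p = (q, C2) \<and> U2i = (q, C2)) \<and>
    min (demand_of U1i) (supply_of U2i) = q"
  unfolding upstream_dichotomy[OF assms(1), symmetric] downstream_dichotomy[OF assms(2), symmetric]
    riemann_states_def eq_commute[of _ q]
  by blast

lemma boundary_flux_eq:
  assumes "U1 \<in> traffic_states C1" "U2 \<in> traffic_states C2"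
    and "riemann_states C1 C2 U1 U2 U1m U1i U2i U2p q"
  shows "q = min (demand_of U1) (supply_of U2)"
proof -
  have "q \<le> demand_of U1" "q \<le> supply_of U2"
    using assms(3) unfolding riemann_states_iff[OF assms(1,2)] by auto
  moreover have False if "q < demand_of U1" "q < supply_of U2"
  proof -
    have "min C1 C2 = q"
      using assms(3) that unfolding riemann_states_iff[OF assms(1,2)] by auto
    then show False
      using that traffic_state_bounds[OF assms(1)] traffic_state_bounds[OF assms(2)] by auto
  qed
  ultimately show ?thesis by fastforce
qed

text \<open>
  The downstream link is starved, so its interior supply is \<open>C2\<close>, strictly above the
  flux. Entropy therefore makes the upstream interior demand equal to \<open>D1\<close>, and the
  lower bound on the interior supply leaves only \<open>(D1, C1)\<close>.
\<close>

lemma riemann_states_demand_limited: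
  assumes U: "U1 \<in> traffic_states C1" "U2 \<in> traffic_states C2"
    and less: "demand_of U1 < supply_of U2"
  shows "(\<exists>q. riemann_states C1 C2 U1 U2 U1m U1i U2i U2p q) \<longleftrightarrow>
    U1m = (demand_of U1, C1) \<and> U1i = (demand_of U1, C1) \<and>
    U2p = (demand_of U1, C2) \<and> U2i = (demand_of U1, C2)"
    (is "?L \<longleftrightarrow> ?R")
proof
  note bounds = traffic_state_bounds[OF U(1)] traffic_state_bounds[OF U(2)]
  assume ?L
  then obtain q where R: "riemann_states C1 C2 U1 U2 U1m U1i U2i U2p q" ..
  have q: "q = demand_of U1"
    using boundary_flux_eq[OF U R] less by simp
  have up: "U1m = (q, C1)" "U1i \<in> traffic_states C1" "q \<le> supply_of U1i"
    and down: "U2p = (q, C2)" "U2i = (q, C2)"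
    and entropy: "min (demand_of U1i) (supply_of U2i) = q"
    using R q less unfolding riemann_states_iff[OF U] by auto
  have "demand_of U1i = q"
    using entropy down q less bounds by (auto simp: min_def split: if_splits)
  then have "U1i = (q, C1)"
    using undercritical_state_eq[OF up(2)] up(3) by simp
  then show ?R using q up down by simp
next
  assume ?R
  then have "riemann_states C1 C2 U1 U2 U1m U1i U2i U2p (demand_of U1)"
    using less traffic_state_bounds[OF U(1)] traffic_state_bounds[OF U(2)]
    unfolding riemann_states_iff[OF U] by (auto simp: traffic_states_def)
  then show ?L ..
qed

lemma riemann_states_supply_limited:
  assumes U: "U1 \<in> traffic_states C1" "U2 \<in> traffic_states C2"
    and less: "supply_of U2 < demand_of U1"
  shows "(\<exists>q. riemann_states C1 C2 U1 U2 U1m U1i U2i U2p q) \<longleftrightarrow>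
    U1m = (C1, supply_of U2) \<and> U1i = (C1, supply_of U2) \<and>
    U2p = (C2, supply_of U2) \<and> U2i = (C2, supply_of U2)"
  using riemann_states_demand_limited[of "prod.swap U2" C2 "prod.swap U1" C1
      "prod.swap U2p" "prod.swap U2i" "prod.swap U1i" "prod.swap U1m"] U less
  unfolding riemann_states_reverse[of C1 C2 U1]
  by (auto simp: swap_mem_traffic_states_iff swap_eq_Pair_iff)

text \<open>
  With \<open>q = D1 = S2\<close> neither link is queued or starved. Entropy makes \<open>q\<close> the
  smaller of the upstream interior demand and the downstream interior supply; whichever of the
  two equals \<open>q\<close> determines its state, and for the other it is only a lower bound.
\<close>

lemma riemann_states_balanced:
  assumes U: "U1 \<in> traffic_states C1" "U2 \<in> traffic_states C2"
    and eq: "demand_of U1 = supply_of U2"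
  shows "(\<exists>q. riemann_states C1 C2 U1 U2 U1m U1i U2i U2p q) \<longleftrightarrow>
    U1m = (demand_of U1, C1) \<and> U2p = (C2, supply_of U2) \<and>
    U1i \<in> traffic_states C1 \<and> U2i \<in> traffic_states C2 \<and>
    (U1i = (demand_of U1, C1) \<and> demand_of U2i \<ge> supply_of U2 \<and> supply_of U2i \<ge> supply_of U2 \<or>
     U2i = (C2, supply_of U2) \<and> supply_of U1i \<ge> demand_of U1 \<and> demand_of U1i \<ge> demand_of U1)"
    (is "?L \<longleftrightarrow> ?R")
proof
  assume ?L
  then obtain q where R: "riemann_states C1 C2 U1 U2 U1m U1i U2i U2p q" ..
  have q: "q = demand_of U1" "q = supply_of U2"
    using boundary_flux_eq[OF U R] eq by simp_all
  have up: "U1m = (q, C1)" "U1i \<in> traffic_states C1" "q \<le> supply_of U1i"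
    and down: "U2p = (C2, q)" "U2i \<in> traffic_states C2" "q \<le> demand_of U2i"
    and entropy: "min (demand_of U1i) (supply_of U2i) = q"
    using R q unfolding riemann_states_iff[OF U] by auto
  consider "demand_of U1i = q" "q \<le> supply_of U2i" | "supply_of U2i = q" "q \<le> demand_of U1i"
    using entropy by linarith
  then show ?R
  proof cases
    case 1
    then have "U1i = (q, C1)"
      using undercritical_state_eq[OF up(2)] up(3) by simp
    then show ?thesis using 1 q up down by simp
  next
    case 2
    then have "U2i = (C2, q)"
      using undercritical_state_eq[of "prod.swap U2i" C2] down(2,3)
      by (simp add: swap_mem_traffic_states_iff swap_eq_Pair_iff)
    then show ?thesis using 2 q up down by simp
  qed
next
  assume ?R
  then have "riemann_states C1 C2 U1 U2 U1m U1i U2i U2p (demand_of U1)"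
    using eq traffic_state_bounds[OF U(1)] traffic_state_bounds[OF U(2)]
    unfolding riemann_states_iff[OF U] by auto
  then show ?L ..
qed

text \<open>
  Take an empty upstream link facing a jammed downstream link, so that nothing moves. The demand
  at the interface is zero, and the downstream interior supply may then be anything.
\<close>

lemma interior_states_not_unique:
  assumes "0 < C1" "0 < C2"
  shows "\<exists>V1 \<in> traffic_states C1. \<exists>V2 \<in> traffic_states C2. demand_of V1 = supply_of V2 \<and>
    (\<exists>U1m U1i U2i U2p q U1m' U1i' U2i' U2p' q'.
      riemann_states C1 C2 V1 V2 U1m U1i U2i U2p q \<and>
      riemann_states C1 C2 V1 V2 U1m' U1i' U2i' U2p' q' \<and>
      (U1i, U2i) \<noteq> (U1i', U2i'))"
proof -
  have V: "(0, C1) \<in> traffic_states C1" "(C2, 0) \<in> traffic_states C2"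
    using assms by (auto simp: traffic_states_def)
  have R: "riemann_states C1 C2 (0, C1) (C2, 0) (0, C1) (0, C1) (C2, s) (C2, 0) 0"
    if "s \<in> {0, C2}" for s
    using that assms unfolding riemann_states_iff[OF V] by (auto simp: traffic_states_def)
  have "((0, C1), (C2, 0)) \<noteq> ((0, C1), (C2, C2))"
    using assms by simp
  then show ?thesis
    using V R[of 0, simplified] R[of C2, simplified] by (metis fst_conv snd_conv)
qed

theorem theorem3:
  fixes Q1 Q2 :: "real \<Rightarrow> real"
    and \<rho>c1 \<rho>j1 C1 \<rho>c2 \<rho>j2 C2 D1 S1 D2 S2 :: real
  assumes "link Q1 \<rho>c1 \<rho>j1 C1"
    and "link Q2 \<rho>c2 \<rho>j2 C2"
    and "(D1, S1) \<in> traffic_states C1"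
    and "(D2, S2) \<in> traffic_states C2"
  shows
    "(D1 < S2 \<longrightarrow>
        (\<forall>U1m U1i U2i U2p.
          (\<exists>q. riemann_states C1 C2 (D1, S1) (D2, S2) U1m U1i U2i U2p q) \<longleftrightarrow>
          U1m = (D1, C1) \<and> U1i = (D1, C1) \<and> U2p = (D1, C2) \<and> U2i = (D1, C2))) \<and>
     (D1 > S2 \<longrightarrow>
        (\<forall>U1m U1i U2i U2p.
          (\<exists>q. riemann_states C1 C2 (D1, S1) (D2, S2) U1m U1i U2i U2p q) \<longleftrightarrow>
          U1m = (C1, S2) \<and> U1i = (C1, S2) \<and> U2p = (C2, S2) \<and> U2i = (C2, S2))) \<and>
     (D1 = S2 \<longrightarrow>
        (\<forall>U1m U1i U2i U2p.
          (\<exists>q. riemann_states C1 C2 (D1, S1) (D2, S2) U1m U1i U2i U2p q) \<longleftrightarrow>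
          U1m = (D1, C1) \<and> U2p = (C2, S2) \<and>
          U1i \<in> traffic_states C1 \<and> U2i \<in> traffic_states C2 \<and>
          (U1i = (D1, C1) \<and> demand_of U2i \<ge> S2 \<and> supply_of U2i \<ge> S2 \<or>
           U2i = (C2, S2) \<and> supply_of U1i \<ge> D1 \<and> demand_of U1i \<ge> D1))) \<and>
     (\<exists>V1 \<in> traffic_states C1. \<exists>V2 \<in> traffic_states C2. demand_of V1 = supply_of V2 \<and>
        (\<exists>U1m U1i U2i U2p q U1m' U1i' U2i' U2p' q'.
          riemann_states C1 C2 V1 V2 U1m U1i U2i U2p q \<and>
          riemann_states C1 C2 V1 V2 U1m' U1i' U2i' U2p' q' \<and>
          (U1i, U2i) \<noteq> (U1i', U2i')))"
proof (intro conjI impI allI)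
  note U = assms(3,4)
  show "(\<exists>q. riemann_states C1 C2 (D1, S1) (D2, S2) U1m U1i U2i U2p q) \<longleftrightarrow>
      U1m = (D1, C1) \<and> U1i = (D1, C1) \<and> U2p = (D1, C2) \<and> U2i = (D1, C2)"
    if "D1 < S2" for U1m U1i U2i U2p
    using riemann_states_demand_limited[OF U] that by simp
  show "(\<exists>q. riemann_states C1 C2 (D1, S1) (D2, S2) U1m U1i U2i U2p q) \<longleftrightarrow>
      U1m = (C1, S2) \<and> U1i = (C1, S2) \<and> U2p = (C2, S2) \<and> U2i = (C2, S2)"
    if "D1 > S2" for U1m U1i U2i U2p
    using riemann_states_supply_limited[OF U] that by simp
  show "(\<exists>q. riemann_states C1 C2 (D1, S1) (D2, S2) U1m U1i U2i U2p q) \<longleftrightarrow>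
      U1m = (D1, C1) \<and> U2p = (C2, S2) \<and>
      U1i \<in> traffic_states C1 \<and> U2i \<in> traffic_states C2 \<and>
      (U1i = (D1, C1) \<and> demand_of U2i \<ge> S2 \<and> supply_of U2i \<ge> S2 \<or>
       U2i = (C2, S2) \<and> supply_of U1i \<ge> D1 \<and> demand_of U1i \<ge> D1)"
    if "D1 = S2" for U1m U1i U2i U2p
    using riemann_states_balanced[OF U] that by simp
qed (rule interior_states_not_unique[OF
      link.capacity_pos[OF assms(1)] link.capacity_pos[OF assms(2)]])

end
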